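(* Let $n$ be an odd positive integer, let $H = \{x\in\mathbb{R}^n : 2\sum_{i=1}^n x_i \le n\}$, and let $C = H\cap[0,1]^n$. Consider the pure integer problem $\max\{\sum_{i=1}^n x_i : x\in C\cap\mathbb{Z}^n\}$. Its optimal value is $\lfloor n/2\rfloor$, and, for every integer $s$ with $1\le s\le\lfloor n/2\rfloor$, any branch-and-bound proof based on split disjunctions of sparsity at most $s$ that certifies $\sum_{i=1}^n x_i\le\lfloor n/2\rfloor$ has size at least $\Omega\left(2^{\frac{n}{2s}}\right)$ (i.e., size at least $\kappa\, 2^{n/(2s)}$ for an absolute constant $\kappa>0$).
   Context: A split disjunction in $\mathbb{R}^n$ (with respect to $\mathbb{Z}^n$) is a union $\{x : \langle\pi,x\rangle\le\pi_0\}\cup\{x:\langle\pi,x\rangle\ge\pi_0+1\}$ with $\pi\in\mathbb{Z}^n$, $\pi_0\in\mathbb{Z}$. It has sparsity at most $s$ if the inequalities describing its two halfspaces have at most $s$ non-zero coefficients, i.e., $\pi$ has at most $s$ non-zero entries. A branch-and-bound proof (based on a family of disjunctions $Q_1\cup\dots\cup Q_k\supseteq\mathbb{Z}^n$) is a finite rooted tree whose nodes are convex subsets of $C$: the root is $C$, and each non-leaf node $N$ has as children the sets $Q_1\cap N,\dots,Q_k\cap N$ for some disjunction $Q_1\cup\dots\cup Q_k$ in the family. It certifies (proves the validity of) an inequality $\langle c,x\rangle\le\gamma$ if this inequality is valid for every leaf (empty leaves satisfy this vacuously). It is not required that the disjunction applied at a node cut off an optimal solution of the relaxation at that node. The size of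 the proof is the total number of nodes of the tree. *)

theory Defs
  imports Complex_Main "Jordan_Normal_Form.Matrix"
begin

text \<open>
  The dimension \<open>n\<close> is quantified inside the scope of the absolute constant, so \<open>\<real>\<^sup>n\<close> is rendered as
  \<^term>\<open>carrier_vec n :: real vec set\<close>; coordinates are indexed by \<open>0, \<dots>, n - 1\<close>.
\<close>

definition int_lattice :: "nat \<Rightarrow> real vec set" where
  "int_lattice n = {x \<in> carrier_vec n. \<forall>i<n. x $ i \<in> \<int>}"

text \<open>
  A disjunction \<open>Q\<^sub>1 \<union> \<dots> \<union> Q\<^sub>k\<close> is represented by the list of the sets \<open>Q\<^sub>i\<close>, since branching uses the
  individual sets and not just their union.
\<close>

definition split_disj :: "nat \<Rightarrow> int vec \<Rightarrow> int \<Rightarrow> real vec set list" where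
  "split_disj n p p0 =
     [{x \<in> carrier_vec n. map_vec real_of_int p \<bullet> x \<le> real_of_int p0},
      {x \<in> carrier_vec n. map_vec real_of_int p \<bullet> x \<ge> real_of_int p0 + 1}]"

definition sparse_split_disjs :: "nat \<Rightarrow> nat \<Rightarrow> real vec set list set" where
  "sparse_split_disjs n s =
     {split_disj n p p0 | p p0. p \<in> carrier_vec n \<and> card {i. i < n \<and> p $ i \<noteq> 0} \<le> s}"

lemma split_disj_covers_int_lattice:
  assumes "p \<in> carrier_vec n"
  shows "int_lattice n \<subseteq> \<Union> (set (split_disj n p p0))"
proof
  fix x assume x: "x \<in> int_lattice n"
  have "map_vec real_of_int p \<bullet> x \<in> \<int>"
    unfolding scalar_prod_def using x assms
    by (intro Ints_sum) (auto simp: int_lattice_def intro!: Ints_mult)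
  then obtain z where z: "map_vec real_of_int p \<bullet> x = real_of_int z"
    by (auto elim: Ints_cases)
  have "z \<le> p0 \<or> z \<ge> p0 + 1" by linarith
  hence "real_of_int z \<le> real_of_int p0 \<or> real_of_int z \<ge> real_of_int p0 + 1" by linarith
  thus "x \<in> \<Union> (set (split_disj n p p0))"
    using x z by (auto simp: split_disj_def int_lattice_def)
qed

datatype 'a bb_tree = BB_Node (region: "'a set") (children: "'a bb_tree list")

primrec leaves :: "'a bb_tree \<Rightarrow> 'a set set" where
  "leaves (BB_Node N ts) = (if ts = [] then {N} else \<Union> (set (map leaves ts)))"

primrec bb_size :: "'a bb_tree \<Rightarrow> nat" where
  "bb_size (BB_Node N ts) = 1 + sum_list (map bb_size ts)"

text \<open>
  Convexity of the nodes is not demanded separately: every node is the intersection of the root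
  with some of the sets \<open>Q\<^sub>i\<close>, hence convex whenever the root and these sets are.
\<close>

inductive bb_tree_over :: "'a set list set \<Rightarrow> 'a bb_tree \<Rightarrow> bool" for F where
  leaf: "bb_tree_over F (BB_Node N [])"
| branch: "Qs \<in> F \<Longrightarrow> map region ts = map (\<lambda>Q. Q \<inter> N) Qs \<Longrightarrow>
    \<forall>t\<in>set ts. bb_tree_over F t \<Longrightarrow> bb_tree_over F (BB_Node N ts)"

definition bb_proof :: "'a set list set \<Rightarrow> 'a set \<Rightarrow> 'a bb_tree \<Rightarrow> bool" where
  "bb_proof F C t \<longleftrightarrow> bb_tree_over F t \<and> region t = C"

definition certifies :: "real vec bb_tree \<Rightarrow> real vec \<Rightarrow> real \<Rightarrow> bool" where
  "certifies t c \<gamma> \<longleftrightarrow> (\<forall>L\<in>leaves t. \<forall>x\<in>L. c \<bullet> x \<le> \<gamma>)"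

definition is_max_value :: "('a \<Rightarrow> real) \<Rightarrow> 'a set \<Rightarrow> real \<Rightarrow> bool" where
  "is_max_value f S v \<longleftrightarrow> (\<exists>x\<in>S. f x = v) \<and> (\<forall>x\<in>S. f x \<le> v)"

definition half_sum_halfspace :: "nat \<Rightarrow> real vec set" where
  "half_sum_halfspace n = {x \<in> carrier_vec n. 2 * (\<Sum>i<n. x $ i) \<le> real n}"

definition unit_cube :: "nat \<Rightarrow> real vec set" where
  "unit_cube n = {x \<in> carrier_vec n. \<forall>i<n. 0 \<le> x $ i \<and> x $ i \<le> 1}"

definition half_sum_cube :: "nat \<Rightarrow> real vec set" where
  "half_sum_cube n = half_sum_halfspace n \<inter> unit_cube n"

end

theory Submission
  imports Defs
begin

text \<open>
  Write \<open>n = 2 m + 1\<close>. Fixing at most \<open>m\<close> coordinates of \<open>C\<close> to values in \<open>{0, 1}\<close> leaves a face that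
  still contains a point of value \<open>n / 2 > m\<close>, so a node containing such a face is no leaf. If all
  0/1 points of the face lie on the same side of the split applied at the node, then by linearity so
  does the whole face, and it passes unchanged to one child. Otherwise there is a 0/1 point of the
  face on each side; additionally fixing the at most \<open>s\<close> coordinates in the support of the split to
  the values of these points gives a face inside each child. Hence the tree branches binarily at
  least \<open>m div s\<close> times along every path that is followed in this way.
\<close>

section \<open>Faces of \<open>half_sum_cube\<close> given by fixed coordinates\<close>

definition cube_face :: "nat \<Rightarrow> nat set \<Rightarrow> (nat \<Rightarrow> real) \<Rightarrow> real vec set" where
  "cube_face n T y = {x \<in> half_sum_cube n. \<forall>i\<in>T. x $ i = y i}"

lemma cube_face_mono:
  assumes "T \<subseteq> T'" "\<And>i. i \<in> T \<Longrightarrow> y' i = y i"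
  shows "cube_face n T' y' \<subseteq> cube_face n T y"
  using assms by (auto simp: cube_face_def)

text \<open>A linear form on a box is maximized coordinatewise: keep \<open>y\<close> on
  \<open>T\<close>, and elsewhere choose 0 or 1 by the sign of \<open>a i\<close>. The point
  \<open>z\<close> may violate the half-sum inequality.\<close>

lemma binary_point_maximizing:
  fixes a x y :: "nat \<Rightarrow> real"
  assumes "\<And>i. i < n \<Longrightarrow> 0 \<le> x i \<and> x i \<le> 1" "\<And>i. i \<in> T \<Longrightarrow> x i = y i" "\<And>i. y i \<in> {0, 1}"
  obtains z where "\<And>i. z i \<in> {0, 1}" "\<And>i. i \<in> T \<Longrightarrow> z i = y i"
    "(\<Sum>i<n. a i * x i) \<le> (\<Sum>i<n. a i * z i)"
proof
  let ?z = "\<lambda>i. if i \<in> T then y i else if a i \<ge> 0 then 1 else 0"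
  have "a i * x i \<le> a i * ?z i" if "i < n" for i
    using assms(1)[OF that] assms(2)[of i]
    by (auto simp: mult_left_le mult_nonpos_nonneg)
  then show "(\<Sum>i<n. a i * x i) \<le> (\<Sum>i<n. a i * ?z i)"
    by (intro sum_mono) auto
qed (use assms(3) in auto)

text \<open>The second assumption ranges over 0/1 points of the whole cube, including those outside
  \<open>half_sum_cube\<close>. This makes rounding each coordinate independently
  legitimate.\<close>

lemma cube_face_on_one_side:
  fixes a y :: "nat \<Rightarrow> real"
  assumes "\<And>i. y i \<in> {0, 1}"
    and "\<And>z. (\<And>i. z i \<in> {0, 1}) \<Longrightarrow> (\<And>i. i \<in> T \<Longrightarrow> z i = y i) \<Longrightarrow> (\<Sum>i<n. a i * z i) \<le> b"
    and "x \<in> cube_face n T y"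
  shows "(\<Sum>i<n. a i * x $ i) \<le> b"
proof -
  have "\<And>i. i < n \<Longrightarrow> 0 \<le> x $ i \<and> x $ i \<le> 1" "\<And>i. i \<in> T \<Longrightarrow> x $ i = y i"
    using assms(3) by (auto simp: cube_face_def half_sum_cube_def unit_cube_def)
  then obtain z where "\<And>i. z i \<in> {0, 1}" "\<And>i. i \<in> T \<Longrightarrow> z i = y i"
    "(\<Sum>i<n. a i * x $ i) \<le> (\<Sum>i<n. a i * z i)"
    using binary_point_maximizing[of n "\<lambda>i. x $ i" T y a] assms(1) by metis
  with assms(2)[of z] show ?thesis
    by auto
qed

lemma cube_face_half_point:
  assumes "T \<subseteq> {..<n}" "2 * card T < n" "\<And>i. y i \<in> {0, 1}"
  obtains x where "x \<in> cube_face n T y" "(\<Sum>i<n. x $ i) = real n / 2"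
proof
  \<comment> \<open>The free coordinates share equally what \<open>y\<close> leaves of the target
    \<open>n / 2\<close>. The common value is in [0, 1] since \<open>sum y T\<close> lies between 0
    and \<open>card T\<close>, which is below \<open>n / 2\<close>.\<close>
  define c where "c = (real n / 2 - sum y T) / (real n - real (card T))"
  define f where "f i = (if i \<in> T then y i else c)" for i
  have fin: "finite T"
    using assms(1) finite_subset by blast
  have y01: "0 \<le> y i" "y i \<le> 1" for i
    using assms(3)[of i] by auto
  have S0: "0 \<le> sum y T"
    using y01 by (simp add: sum_nonneg)
  have S1: "sum y T \<le> real (card T)"
    using sum_mono[of T y "\<lambda>_. 1"] y01 by simp
  have T: "2 * real (card T) < real n"
    using assms(2) by linarith
  have c01: "0 \<le> c" "c \<le> 1"
    using S0 S1 T by (auto simp: c_def field_simps)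
  have "(\<Sum>i<n. f i) = sum f T + sum f ({..<n} - T)"
    using assms(1) by (simp add: sum.subset_diff add.commute)
  also have "sum f T = sum y T"
    by (intro sum.cong) (auto simp: f_def)
  also have "sum f ({..<n} - T) = (\<Sum>i\<in>{..<n} - T. c)"
    by (intro sum.cong) (auto simp: f_def)
  also have "\<dots> = (real n - real (card T)) * c"
    using fin assms(1,2) by (simp add: card_Diff_subset of_nat_diff)
  also have "sum y T + \<dots> = real n / 2"
    using T by (simp add: c_def)
  finally have sum: "(\<Sum>i<n. f i) = real n / 2" .
  then show sum': "(\<Sum>i<n. vec n f $ i) = real n / 2"
    by simp
  show "vec n f \<in> cube_face n T y"
    using sum' y01 c01 assms(1)
    by (auto simp: cube_face_def half_sum_cube_def half_sum_halfspace_def unit_cube_def f_def)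
qed

text \<open>Once its whole support is fixed, the linear form is constant on the face, so its value
  at \<open>z\<close> decides the side.\<close>

lemma cube_face_halfspace:
  fixes a z :: "nat \<Rightarrow> real"
  assumes "(\<Sum>i<n. a i * z i) \<le> b" "{i. i < n \<and> a i \<noteq> 0} \<subseteq> T" "x \<in> cube_face n T z"
  shows "(\<Sum>i<n. a i * x $ i) \<le> b"
proof -
  have "(\<Sum>i<n. a i * x $ i) = (\<Sum>i<n. a i * z i)"
    using assms(2,3) by (intro sum.cong) (auto simp: cube_face_def)
  then show ?thesis
    using assms(1) by simp
qed

section \<open>Splits on faces, and the induction over the tree\<close>

lemma binary_sum_Ints:
  fixes z :: "nat \<Rightarrow> real"
  assumes "\<And>i. z i \<in> {0, 1}"
  shows "(\<Sum>i<n. real_of_int (p $ i) * z i) \<in> \<int>"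
proof (intro Ints_sum Ints_mult)
  show "z i \<in> \<int>" for i
    using assms[of i] by auto
qed auto

text \<open>The dichotomy between passing a face on whole and shrinking it once per child. In the
  second case \<open>z\<close> depends on \<open>Q\<close>, and it agrees with \<open>y\<close> only
  on \<open>T\<close>.\<close>

lemma split_disj_cases:
  fixes y :: "nat \<Rightarrow> real"
  assumes p: "p \<in> carrier_vec n" and y: "\<And>i. y i \<in> {0, 1}"
  obtains (one_side) Q where "Q \<in> set (split_disj n p p0)" "cube_face n T y \<subseteq> Q"
  | (both_sides) "\<forall>Q\<in>set (split_disj n p p0). \<exists>z. (\<forall>i. z i \<in> {0, 1}) \<and>
      (\<forall>i\<in>T. z i = y i) \<and> cube_face n (T \<union> {i. i < n \<and> p $ i \<noteq> 0}) z \<subseteq> Q"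
proof -
  let ?a = "\<lambda>i. real_of_int (p $ i)" and ?P = "{i. i < n \<and> p $ i \<noteq> 0}"
  let ?ext = "\<lambda>z::nat \<Rightarrow> real. (\<forall>i. z i \<in> {0, 1}) \<and> (\<forall>i\<in>T. z i = y i)"
  define L where "L = {x \<in> carrier_vec n. (\<Sum>i<n. ?a i * x $ i) \<le> real_of_int p0}"
  \<comment> \<open>The second halfspace is written as an upper bound on the negated form, so that
    the same lemmas serve both sides.\<close>
  define R where "R = {x \<in> carrier_vec n. (\<Sum>i<n. - ?a i * x $ i) \<le> - real_of_int p0 - 1}"
  have prod: "map_vec real_of_int p \<bullet> x = (\<Sum>i<n. ?a i * x $ i)" if "x \<in> carrier_vec n" for x
    using p that by (auto simp: scalar_prod_def lessThan_atLeast0)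
  have disj: "split_disj n p p0 = [L, R]"
    by (auto simp: split_disj_def L_def R_def prod sum_negf)
  have sub: "cube_face n T' z \<subseteq> carrier_vec n" for T' z
    by (auto simp: cube_face_def half_sum_cube_def unit_cube_def)
  \<comment> \<open>By integrality, no 0/1 point lies strictly between the two sides; so a point
    that fails one inequality satisfies the other.\<close>
  have int: "(\<Sum>i<n. ?a i * z i) \<le> real_of_int p0 \<or> (\<Sum>i<n. - ?a i * z i) \<le> - real_of_int p0 - 1"
    if z: "?ext z" for z
  proof -
    obtain k where "(\<Sum>i<n. ?a i * z i) = real_of_int k"
      using binary_sum_Ints[of z p n] z Ints_cases by blast
    then show ?thesis
      by (auto simp: sum_negf)
  qed
  consider "\<forall>z. ?ext z \<longrightarrow> (\<Sum>i<n. ?a i * z i) \<le> real_of_int p0"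
    | "\<forall>z. ?ext z \<longrightarrow> (\<Sum>i<n. - ?a i * z i) \<le> - real_of_int p0 - 1"
    | z1 z2 where "?ext z1" "(\<Sum>i<n. ?a i * z1 i) \<le> real_of_int p0"
        "?ext z2" "(\<Sum>i<n. - ?a i * z2 i) \<le> - real_of_int p0 - 1"
    using int by blast
  then show thesis
  proof cases
    case 1
    then have "(\<Sum>i<n. ?a i * x $ i) \<le> real_of_int p0" if "x \<in> cube_face n T y" for x
      by (intro cube_face_on_one_side[OF y _ that]) simp
    then have "cube_face n T y \<subseteq> L"
      using sub by (auto simp: L_def)
    then show ?thesis
      using one_side[of L] disj by simp
  next
    case 2
    then have "(\<Sum>i<n. - ?a i * x $ i) \<le> - real_of_int p0 - 1" if "x \<in> cube_face n T y" for x
      by (intro cube_face_on_one_side[OF y _ that]) simp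
    then have "cube_face n T y \<subseteq> R"
      using sub by (auto simp: R_def)
    then show ?thesis
      using one_side[of R] disj by simp
  next
    case (3 z1 z2)
    have "(\<Sum>i<n. ?a i * x $ i) \<le> real_of_int p0" if "x \<in> cube_face n (T \<union> ?P) z1" for x
      by (rule cube_face_halfspace[OF 3(2) _ that]) auto
    then have "cube_face n (T \<union> ?P) z1 \<subseteq> L"
      using sub by (auto simp: L_def)
    moreover have "(\<Sum>i<n. - ?a i * x $ i) \<le> - real_of_int p0 - 1"
      if "x \<in> cube_face n (T \<union> ?P) z2" for x
      by (rule cube_face_halfspace[OF 3(4) _ that]) auto
    then have "cube_face n (T \<union> ?P) z2 \<subseteq> R"
      using sub by (auto simp: R_def)
    ultimately show ?thesis
      using both_sides disj 3(1,3) by auto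
  qed
qed

text \<open>Here \<open>j\<close> counts the binary branchings still guaranteed, each costing at
  most \<open>s\<close> fixed coordinates; the last assumption is the budget for them. The region
  need only contain the face, and the induction is on the tree because a split may leave
  \<open>T\<close>, \<open>y\<close> and \<open>j\<close> unchanged.\<close>

lemma bb_size_ge_if_contains_cube_face:
  assumes "bb_tree_over (sparse_split_disjs n s) t"
    and "certifies t (vec n (\<lambda>_. 1)) \<gamma>" "\<gamma> < real n / 2"
    and "cube_face n T y \<subseteq> region t" "T \<subseteq> {..<n}" "\<And>i. y i \<in> {0, 1}"
    and "2 * (card T + s * j) < n"
  shows "2 ^ j \<le> bb_size t"
  using assms
proof (induction arbitrary: T y j rule: bb_tree_over.induct)
  case (leaf N)
  \<comment> \<open>A leaf is impossible: this point lies in it and has value \<open>n / 2\<close>,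
    above the certified bound.\<close>
  obtain x where x: "x \<in> cube_face n T y" "(\<Sum>i<n. x $ i) = real n / 2"
    using cube_face_half_point[of T n y] leaf.prems by auto
  have "x \<in> carrier_vec n"
    using x(1) by (auto simp: cube_face_def half_sum_cube_def unit_cube_def)
  then have "vec n (\<lambda>_. 1) \<bullet> x = real n / 2"
    using x(2) by (auto simp: scalar_prod_def lessThan_atLeast0)
  then show ?case
    using x(1) leaf.prems by (force simp: certifies_def)
next
  case (branch Qs ts N)
  obtain p p0 where p: "p \<in> carrier_vec n" "card {i. i < n \<and> p $ i \<noteq> 0} \<le> s"
    and Qs: "Qs = split_disj n p p0"
    using branch.hyps(1) by (auto simp: sparse_split_disjs_def)
  let ?P = "{i. i < n \<and> p $ i \<noteq> 0}"
  have cert: "certifies t (vec n (\<lambda>_. 1)) \<gamma>" if "t \<in> set ts" for t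
    using branch.prems(1) that by (auto simp: certifies_def split: if_splits)
  have child: "2 ^ j' \<le> bb_size t"
    if "t \<in> set ts" "region t = Q \<inter> N" "cube_face n T' z \<subseteq> Q" "cube_face n T' z \<subseteq> N"
      "T' \<subseteq> {..<n}" "\<And>i. z i \<in> {0, 1}" "2 * (card T' + s * j') < n" for t Q T' z j'
  proof -
    have "cube_face n T' z \<subseteq> region t"
      using that(2-4) by blast
    then show ?thesis
      using bspec[OF branch.IH that(1)] cert[OF that(1)] branch.prems(2) that(5-7) by simp
  qed
  have len: "length ts = 2"
    using arg_cong[OF branch.hyps(2), of length] by (simp add: Qs split_disj_def)
  obtain t1 t2 where ts: "ts = [t1, t2]"
    using len by (auto simp: numeral_2_eq_2 length_Suc_conv)
  have regions: "\<exists>t\<in>set ts. region t = Q \<inter> N" if "Q \<in> set Qs" for Q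
  proof -
    have "Q \<inter> N \<in> set (map region ts)"
      using branch.hyps(2) that by auto
    then show ?thesis
      by auto
  qed
  consider (one_side) Q where "Q \<in> set Qs" "cube_face n T y \<subseteq> Q"
    | (both_sides) "\<forall>Q\<in>set Qs. \<exists>z. (\<forall>i. z i \<in> {0, 1}) \<and>
        (\<forall>i\<in>T. z i = y i) \<and> cube_face n (T \<union> ?P) z \<subseteq> Q"
    unfolding Qs
    by (rule split_disj_cases[OF p(1) branch.prems(5), where ?p0.0 = p0 and T = T])
  then show ?case
  proof cases
    case (one_side Q)
    then obtain t where t: "t \<in> set ts" "region t = Q \<inter> N"
      using regions by blast
    have "2 ^ j \<le> bb_size t"
      using child[OF t one_side(2) _ branch.prems(4,5,6)] branch.prems(3) by simp
    also have "bb_size t \<le> bb_size (BB_Node N ts)"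
      using t(1) by (auto simp: ts)
    finally show ?thesis .
  next
    case both_sides
    show ?thesis
    \<comment> \<open>For \<open>j = 0\<close> the node itself suffices. Otherwise both children
      receive a face with budget \<open>j - 1\<close>, and their bounds add up to
      \<open>2 ^ j\<close>.\<close>
    proof (cases j)
      case (Suc j')
      have card: "card (T \<union> ?P) \<le> card T + s"
        using card_Un_le[of T ?P] p(2) by linarith
      have bound: "2 ^ j' \<le> bb_size t" if t: "t \<in> set ts" for t
      proof -
        have "region t \<in> (\<lambda>Q. Q \<inter> N) ` set Qs"
          using branch.hyps(2) t by (metis image_eqI list.set_map)
        then obtain Q where Q: "Q \<in> set Qs" "region t = Q \<inter> N"
          by blast
        then obtain z where z: "\<forall>i. z i \<in> {0, 1}" "\<forall>i\<in>T. z i = y i"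
          and zQ: "cube_face n (T \<union> ?P) z \<subseteq> Q"
          using both_sides by blast
        have "cube_face n (T \<union> ?P) z \<subseteq> cube_face n T y"
          using z(2) by (intro cube_face_mono) auto
        then have zN: "cube_face n (T \<union> ?P) z \<subseteq> N"
          using branch.prems(3) by simp
        show ?thesis
        proof (rule child[OF t Q(2) zQ zN])
          show "T \<union> ?P \<subseteq> {..<n}"
            using branch.prems(4) by auto
          show "z i \<in> {0, 1}" for i
            using z(1) by blast
          have "card (T \<union> ?P) + s * j' \<le> card T + s * j"
            using card by (simp add: Suc)
          then have "2 * (card (T \<union> ?P) + s * j') \<le> 2 * (card T + s * j)"
            by (rule mult_le_mono2)
          then show "2 * (card (T \<union> ?P) + s * j') < n"
            using branch.prems(6) by (rule le_less_trans)
        qed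
      qed
      show ?thesis
        using bound[of t1] bound[of t2] by (simp add: ts Suc)
    qed simp
  qed
qed

section \<open>The integer optimum and the final estimate\<close>

lemma floor_half_odd: "\<lfloor>real (2 * m + 1) / 2\<rfloor> = int m"
  by (rule floor_unique) auto

lemma half_sum_cube_max_value:
  assumes "n = 2 * m + 1"
  shows "is_max_value (\<lambda>x. \<Sum>i<n. x $ i) (half_sum_cube n \<inter> int_lattice n) (real m)"
  unfolding is_max_value_def
proof (intro conjI ballI)
  define f where "f i = (if i < m then 1 else 0 :: real)" for i
  have "(\<Sum>i<n. f i) = (\<Sum>i<m. 1)"
    using assms by (intro sum.mono_neutral_cong_right) (auto simp: f_def)
  then have sum: "(\<Sum>i<n. vec n f $ i) = real m"
    by simp
  have "vec n f \<in> half_sum_cube n \<inter> int_lattice n"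
    using assms sum
    by (auto simp: half_sum_cube_def half_sum_halfspace_def unit_cube_def int_lattice_def f_def)
  then show "\<exists>x\<in>half_sum_cube n \<inter> int_lattice n. (\<Sum>i<n. x $ i) = real m"
    using sum by blast
next
  fix x assume x: "x \<in> half_sum_cube n \<inter> int_lattice n"
  have "(\<Sum>i<n. x $ i) \<in> \<int>"
    using x by (intro Ints_sum) (auto simp: int_lattice_def)
  then obtain k where k: "(\<Sum>i<n. x $ i) = real_of_int k"
    by (auto elim: Ints_cases)
  moreover have "2 * (\<Sum>i<n. x $ i) \<le> real n"
    using x by (auto simp: half_sum_cube_def half_sum_halfspace_def)
  \<comment> \<open>Integrality and oddness: \<open>2 * k\<close> is at most
    \<open>2 * m + 1\<close>.\<close>
  ultimately have "k \<le> int m"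
    using assms by linarith
  then show "(\<Sum>i<n. x $ i) \<le> real m"
    using k by simp
qed

theorem theorem1p4:
  shows "\<exists>\<kappa>::real. \<kappa> > 0 \<and> (\<forall>n::nat. odd n \<longrightarrow>
     is_max_value (\<lambda>x. \<Sum>i<n. x $ i) (half_sum_cube n \<inter> int_lattice n)
       (real_of_int \<lfloor>real n / 2\<rfloor>) \<and>
     (\<forall>s::nat. 1 \<le> s \<and> int s \<le> \<lfloor>real n / 2\<rfloor> \<longrightarrow>
        (\<forall>t. bb_proof (sparse_split_disjs n s) (half_sum_cube n) t \<and>
             certifies t (vec n (\<lambda>_. 1)) (real_of_int \<lfloor>real n / 2\<rfloor>) \<longrightarrow>
             real (bb_size t) \<ge> \<kappa> * 2 powr (real n / (2 * real s)))))"
proof (intro exI[of _ "1 / 4"] conjI allI impI)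
  fix n :: nat assume "odd n"
  then obtain m where n: "n = 2 * m + 1"
    by (elim oddE)
  have fl: "\<lfloor>real n / 2\<rfloor> = int m"
    unfolding n by (rule floor_half_odd)
  show "is_max_value (\<lambda>x. \<Sum>i<n. x $ i) (half_sum_cube n \<inter> int_lattice n)
      (real_of_int \<lfloor>real n / 2\<rfloor>)"
    using half_sum_cube_max_value[OF n] fl by simp
  fix s t
  assume s: "1 \<le> s \<and> int s \<le> \<lfloor>real n / 2\<rfloor>"
    and t: "bb_proof (sparse_split_disjs n s) (half_sum_cube n) t \<and>
      certifies t (vec n (\<lambda>_. 1)) (real_of_int \<lfloor>real n / 2\<rfloor>)"
  \<comment> \<open>The largest \<open>j\<close> with \<open>s * j\<close> at most \<open>m\<close>,
    that is, with \<open>2 * (s * j) < n\<close>; the induction starts at the root with no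
    coordinate fixed.\<close>
  let ?j = "m div s"
  have "2 ^ ?j \<le> bb_size t"
  proof (rule bb_size_ge_if_contains_cube_face)
    show "cube_face n {} (\<lambda>_. 0) \<subseteq> region t"
      using t by (auto simp: bb_proof_def cube_face_def)
    show "2 * (card ({} :: nat set) + s * ?j) < n"
      using n by (simp add: le_imp_less_Suc)
  qed (use t fl n in \<open>auto simp: bb_proof_def\<close>)
  then have size: "2 ^ ?j \<le> real (bb_size t)"
    by (metis of_nat_le_iff of_nat_numeral of_nat_power)
  have "m < s * (?j + 1)"
    using s dividend_less_times_div[of s m] by (simp add: add.commute)
  then have "n \<le> 2 * s * (?j + 1)"
    using n by linarith
  then have "real n \<le> real (?j + 1) * (2 * real s)"
    by (metis mult.commute mult.left_commute of_nat_le_iff of_nat_mult of_nat_numeral)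
  then have "real n / (2 * real s) \<le> real (?j + 1)"
    using s by (simp add: pos_divide_le_eq)
  then have "2 powr (real n / (2 * real s)) \<le> 2 powr real (?j + 1)"
    by (intro powr_mono) auto
  also have "\<dots> = 2 * 2 ^ ?j"
    by (subst powr_realpow) auto
  \<comment> \<open>Rounding down in \<open>m div s\<close> costs at most a factor 2 here, so the
    constant 1/4 leaves room to spare.\<close>
  finally show "1 / 4 * 2 powr (real n / (2 * real s)) \<le> real (bb_size t)"
    using size by linarith
qed simp

end
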